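(* Consider the system (of type $A_7^{(2)}$) $$\frac{dx}{dt}=\frac{\partial H}{\partial y},\quad \frac{dy}{dt}=-\frac{\partial H}{\partial x},\quad \frac{dz}{dt}=\frac{\partial H}{\partial w},\quad \frac{dw}{dt}=-\frac{\partial H}{\partial z}$$ with $$\begin{aligned} t(t-1)H =\;&x^2y^3-((t+1)x+2\alpha_2+\alpha_3+\alpha_4)xy^2\\ &+\{tx^2+(\alpha_0+2\alpha_2+\alpha_3+\alpha_4-(\alpha_0+\alpha_1)t)x+\alpha_2(\alpha_2+\alpha_3+\alpha_4)\}y+\alpha_1 t x\\ &+\tfrac{1}{4}\big[-z^2w^4+2\alpha_4 zw^3+((2t-1)z^2-\alpha_4^2)w^2\\ &\qquad-2\{-\alpha_0-2\alpha_2-\alpha_3-\alpha_4+(\alpha_4+1)t\}zw-t(t-1)z^2\big]\\ &+y((y-1)x-\alpha_2)zw, \end{aligned}$$ where $\alpha_0+\alpha_1+2\alpha_2+2\alpha_3+\alpha_4=1$. Make the change of parameters and variables $$\alpha_0=\frac{1}{\varepsilon}+A_0,\quad \alpha_1=-\frac{1}{\varepsilon},\quad \alpha_2=A_1,\quad \alpha_3=A_2,\quad \alpha_4=A_3,$$ $$t=\frac{T}{\varepsilon},\quad x=\varepsilon X,\quad y=\frac{Y}{\varepsilon},\quad z=\sqrt{\varepsilon}\,Z,\quad w=\frac{W}{\sqrt{\varepsilon}}$$ from $\alpha_0,\dots,\alpha_4,t,x,y,z,w$ to $A_0,A_1,A_2,A_3,\varepsilon,T,X,Y,Z,W$ (so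 that $A_0+2A_1+2A_2+A_3=1$). Then the system can also be written in the new variables $X,Y,Z,W$ (with independent variable $T$) and parameters $A_0,A_1,A_2,A_3$ as a Hamiltonian system, and as $\varepsilon\to0$ this new system tends to the Hamiltonian system $$\frac{dX}{dT}=\frac{\partial \tilde H}{\partial Y},\quad \frac{dY}{dT}=-\frac{\partial \tilde H}{\partial X},\quad \frac{dZ}{dT}=\frac{\partial \tilde H}{\partial W},\quad \frac{dW}{dT}=-\frac{\partial \tilde H}{\partial Z}$$ with the polynomial Hamiltonian $\tilde H$ given by $$\begin{aligned} T^2\tilde H =\;&X^2Y^3-(TX+2A_1+A_2+A_3)XY^2-\{(A_0 T-1)X-A_1(A_1+A_2+A_3)\}Y-TX\\ &-\frac{Z^2W^4}{4}+\frac{A_3}{2}ZW^3+\frac{1}{4}(2TZ^2-A_3^2)W^2-\frac{1}{2}\{(A_3+1)T-1\}ZW-\frac{T^2 Z^2}{4}\\ &+(XY-A_1)YZW. \end{aligned}$$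
   Context: All variables and parameters are complex, $\varepsilon\neq0$, and a fixed choice of $\sqrt{\varepsilon}$ is made. "Tends to" means that, with $A_0,\dots,A_3$ fixed, the right-hand sides of the differential equations in $X,Y,Z,W,T$ converge as $\varepsilon\to0$ (coefficientwise as polynomials in $X,Y,Z,W$) to those of the limiting system. *)

theory Defs
  imports "HOL-Analysis.Analysis"
begin

text \<open>
  A (time-dependent) function on the phase space with coordinates \<open>x, y, z, w\<close> is written
  \<open>F t x y z w\<close>; the conjugate pairs are \<open>(x, y)\<close> and \<open>(z, w)\<close>.
\<close>

type_synonym phase_fun = "complex \<Rightarrow> complex \<Rightarrow> complex \<Rightarrow> complex \<Rightarrow> complex"

definition rhs_x :: "(complex \<Rightarrow> phase_fun) \<Rightarrow> complex \<Rightarrow> phase_fun" where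
  "rhs_x F t x y z w = deriv (\<lambda>v. F t x v z w) y"

definition rhs_y :: "(complex \<Rightarrow> phase_fun) \<Rightarrow> complex \<Rightarrow> phase_fun" where
  "rhs_y F t x y z w = - deriv (\<lambda>v. F t v y z w) x"

definition rhs_z :: "(complex \<Rightarrow> phase_fun) \<Rightarrow> complex \<Rightarrow> phase_fun" where
  "rhs_z F t x y z w = deriv (\<lambda>v. F t x y z v) w"

definition rhs_w :: "(complex \<Rightarrow> phase_fun) \<Rightarrow> complex \<Rightarrow> phase_fun" where
  "rhs_w F t x y z w = - deriv (\<lambda>v. F t x y v w) z"

definition solves_hamiltonian_system ::
  "(complex \<Rightarrow> phase_fun) \<Rightarrow> complex set \<Rightarrow> (complex \<Rightarrow> complex) \<Rightarrow> (complex \<Rightarrow> complex) \<Rightarrow>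
   (complex \<Rightarrow> complex) \<Rightarrow> (complex \<Rightarrow> complex) \<Rightarrow> bool" where
  "solves_hamiltonian_system F U x y z w \<longleftrightarrow> (\<forall>t\<in>U.
     (x has_field_derivative rhs_x F t (x t) (y t) (z t) (w t)) (at t) \<and>
     (y has_field_derivative rhs_y F t (x t) (y t) (z t) (w t)) (at t) \<and>
     (z has_field_derivative rhs_z F t (x t) (y t) (z t) (w t)) (at t) \<and>
     (w has_field_derivative rhs_w F t (x t) (y t) (z t) (w t)) (at t))"

text \<open>
  \<open>poly_with_coeffs f c\<close>: \<open>f\<close> is the polynomial function in four variables in which the monomial
  with exponents \<open>(i, j, k, l)\<close> has coefficient \<open>c (i, j, k, l)\<close>. As \<open>\<complex>\<close> is infinite, \<open>f\<close>
  determines \<open>c\<close>.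
\<close>

definition poly_with_coeffs :: "phase_fun \<Rightarrow> (nat \<times> nat \<times> nat \<times> nat \<Rightarrow> complex) \<Rightarrow> bool" where
  "poly_with_coeffs f c \<longleftrightarrow> finite {m. c m \<noteq> 0} \<and>
     (\<forall>x y z w. f x y z w =
        (\<Sum>(i, j, k, l)\<in>{m. c m \<noteq> 0}. c (i, j, k, l) * x ^ i * y ^ j * z ^ k * w ^ l))"

definition is_poly_fun :: "phase_fun \<Rightarrow> bool" where
  "is_poly_fun f \<longleftrightarrow> (\<exists>c. poly_with_coeffs f c)"

text \<open>
  Coefficientwise convergence, as \<open>\<epsilon> \<rightarrow> 0\<close> through nonzero complex values, of a family of
  functions that are polynomial for all sufficiently small \<open>\<epsilon> \<noteq> 0\<close>.
\<close>

definition tends_coeffwise :: "(complex \<Rightarrow> phase_fun) \<Rightarrow> phase_fun \<Rightarrow> bool" where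
  "tends_coeffwise f g \<longleftrightarrow> (\<exists>c d.
     (\<forall>\<^sub>F \<epsilon> in at 0. poly_with_coeffs (f \<epsilon>) (c \<epsilon>)) \<and> poly_with_coeffs g d \<and>
     (\<forall>m. ((\<lambda>\<epsilon>. c \<epsilon> m) \<longlongrightarrow> d m) (at 0)))"

text \<open>
  Both Hamiltonians are given up to a denominator, so \<open>H_A7\<close> is only meaningful for
  \<open>t \<notin> {0, 1}\<close> and \<open>H_limit\<close> for \<open>T \<noteq> 0\<close>. The relation
  \<open>\<alpha>\<^sub>0 + \<alpha>\<^sub>1 + 2\<alpha>\<^sub>2 + 2\<alpha>\<^sub>3 + \<alpha>\<^sub>4 = 1\<close> is not built into the definitions.
\<close>

definition H_A7 ::
  "complex \<Rightarrow> complex \<Rightarrow> complex \<Rightarrow> complex \<Rightarrow> complex \<Rightarrow> complex \<Rightarrow> phase_fun" where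
  "H_A7 \<alpha>0 \<alpha>1 \<alpha>2 \<alpha>3 \<alpha>4 t x y z w =
     (x^2 * y^3 - ((t + 1) * x + 2 * \<alpha>2 + \<alpha>3 + \<alpha>4) * x * y^2
      + (t * x^2 + (\<alpha>0 + 2 * \<alpha>2 + \<alpha>3 + \<alpha>4 - (\<alpha>0 + \<alpha>1) * t) * x + \<alpha>2 * (\<alpha>2 + \<alpha>3 + \<alpha>4)) * y
      + \<alpha>1 * t * x
      + (1 / 4) * (- (z^2 * w^4) + 2 * \<alpha>4 * z * w^3 + ((2 * t - 1) * z^2 - \<alpha>4^2) * w^2
          - 2 * (- \<alpha>0 - 2 * \<alpha>2 - \<alpha>3 - \<alpha>4 + (\<alpha>4 + 1) * t) * z * w - t * (t - 1) * z^2)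
      + y * ((y - 1) * x - \<alpha>2) * z * w)
     / (t * (t - 1))"

definition H_limit ::
  "complex \<Rightarrow> complex \<Rightarrow> complex \<Rightarrow> complex \<Rightarrow> complex \<Rightarrow> phase_fun" where
  "H_limit A0 A1 A2 A3 T X Y Z W =
     (X^2 * Y^3 - (T * X + 2 * A1 + A2 + A3) * X * Y^2
      - ((A0 * T - 1) * X - A1 * (A1 + A2 + A3)) * Y - T * X
      - Z^2 * W^4 / 4 + A3 / 2 * Z * W^3 + (1 / 4) * (2 * T * Z^2 - A3^2) * W^2
      - (1 / 2) * ((A3 + 1) * T - 1) * Z * W - T^2 * Z^2 / 4
      + (X * Y - A1) * Y * Z * W)
     / T^2"

end

theory Submission imports Defs begin

text \<open>
  Two observations carry the proof.

  First, the substitution \<open>x = \<epsilon>X\<close>, \<open>y = Y/\<epsilon>\<close>, \<open>z = \<surd>\<epsilon> Z\<close>, \<open>w = W/\<surd>\<epsilon>\<close> scales the members of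
  each conjugate pair by inverse factors, so it preserves \<open>dx \<and> dy + dz \<and> dw\<close>; only time is
  stretched, by the factor \<open>1/\<epsilon>\<close>. Hence the transformed system is again Hamiltonian, with
  Hamiltonian \<open>H(T/\<epsilon>, \<epsilon>X, Y/\<epsilon>, \<surd>\<epsilon> Z, W/\<surd>\<epsilon>) / \<epsilon>\<close> (\<open>solves_hamiltonian_system_rescale\<close>).

  Secondly, since \<open>t (t - 1) = T (T - \<epsilon>) / \<epsilon>\<^sup>2\<close>, and since the numerator \<open>t (t - 1) H\<close> involves
  \<open>\<surd>\<epsilon>\<close> only through its square and has at worst a simple pole at \<open>\<epsilon> = 0\<close>, this Hamiltonian is
  \<open>1 / (T (T - \<epsilon>))\<close> times a polynomial in \<open>X, Y, Z, W\<close> whose coefficients are polynomial in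
  \<open>\<epsilon>\<close> (\<open>H_A7_rescaled\<close>). It makes sense at \<open>\<epsilon> = 0\<close>, where it is the limiting Hamiltonian
  (\<open>H_deformed_0\<close>). The coefficients are therefore continuous at \<open>\<epsilon> = 0\<close> as long as \<open>T \<noteq> 0\<close>,
  so the Hamiltonians converge coefficientwise, and differentiating a polynomial only shifts
  its coefficients and multiplies them by integers, so the right-hand sides converge as well.
\<close>

section \<open>Polynomial functions and coefficientwise convergence\<close>

text \<open>The sum may be extended over any finite set of exponents that contains the support.\<close>

lemma poly_with_coeffsI:
  assumes "finite S" and supp: "\<And>m. m \<notin> S \<Longrightarrow> c m = 0"
    and f: "\<And>x y z w. f x y z w = (\<Sum>(i, j, k, l)\<in>S. c (i, j, k, l) * x ^ i * y ^ j * z ^ k * w ^ l)"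
  shows "poly_with_coeffs f c"
proof -
  have sub: "{m. c m \<noteq> 0} \<subseteq> S"
    using supp by auto
  have "(\<Sum>(i, j, k, l)\<in>S. c (i, j, k, l) * x ^ i * y ^ j * z ^ k * w ^ l)
      = (\<Sum>(i, j, k, l)\<in>{m. c m \<noteq> 0}. c (i, j, k, l) * x ^ i * y ^ j * z ^ k * w ^ l)"
    for x y z w
    by (rule sum.mono_neutral_right) (use \<open>finite S\<close> sub in auto)
  then show ?thesis
    using f finite_subset[OF sub \<open>finite S\<close>] by (simp add: poly_with_coeffs_def)
qed

lemma poly_with_coeffs_uminus:
  assumes "poly_with_coeffs f c"
  shows "poly_with_coeffs (\<lambda>x y z w. - f x y z w) (\<lambda>m. - c m)"
  using assms unfolding poly_with_coeffs_def
  by (simp add: case_prod_unfold flip: sum_negf)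

lemma poly_with_coeffs_swap_xy:
  assumes "poly_with_coeffs f c"
  shows "poly_with_coeffs (\<lambda>x y z w. f y x z w) (\<lambda>(i, j, k, l). c (j, i, k, l))"
proof (rule poly_with_coeffsI[where S = "(\<lambda>(i, j, k, l). (j, i, k, l)) ` {m. c m \<noteq> 0}"])
  show "finite ((\<lambda>(i, j, k, l). (j, i, k, l)) ` {m. c m \<noteq> 0})"
    using assms by (simp add: poly_with_coeffs_def)
next
  fix x y z w
  have "inj_on (\<lambda>(i, j, k, l). (j, i, k, l)) {m. c m \<noteq> 0}"
    by (auto simp: inj_on_def)
  then show "f y x z w = (\<Sum>(i, j, k, l)\<in>(\<lambda>(i, j, k, l). (j, i, k, l)) ` {m. c m \<noteq> 0}.
      (case (i, j, k, l) of (i, j, k, l) \<Rightarrow> c (j, i, k, l)) * x ^ i * y ^ j * z ^ k * w ^ l)"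
    using assms
    by (simp add: sum.reindex poly_with_coeffs_def case_prod_unfold mult_ac)
qed force

lemma poly_with_coeffs_swap_pairs:
  assumes "poly_with_coeffs f c"
  shows "poly_with_coeffs (\<lambda>x y z w. f z w x y) (\<lambda>(i, j, k, l). c (k, l, i, j))"
proof (rule poly_with_coeffsI[where S = "(\<lambda>(i, j, k, l). (k, l, i, j)) ` {m. c m \<noteq> 0}"])
  show "finite ((\<lambda>(i, j, k, l). (k, l, i, j)) ` {m. c m \<noteq> 0})"
    using assms by (simp add: poly_with_coeffs_def)
next
  fix x y z w
  have "inj_on (\<lambda>(i, j, k, l). (k, l, i, j)) {m. c m \<noteq> 0}"
    by (auto simp: inj_on_def)
  then show "f z w x y = (\<Sum>(i, j, k, l)\<in>(\<lambda>(i, j, k, l). (k, l, i, j)) ` {m. c m \<noteq> 0}.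
      (case (i, j, k, l) of (i, j, k, l) \<Rightarrow> c (k, l, i, j)) * x ^ i * y ^ j * z ^ k * w ^ l)"
    using assms
    by (simp add: sum.reindex poly_with_coeffs_def case_prod_unfold mult_ac)
qed force

lemma poly_with_coeffs_deriv_fst:
  assumes "poly_with_coeffs f c"
  shows "poly_with_coeffs (\<lambda>x y z w. deriv (\<lambda>v. f v y z w) x)
           (\<lambda>(i, j, k, l). of_nat (Suc i) * c (Suc i, j, k, l))"
proof (rule poly_with_coeffsI[where S = "(\<lambda>(i, j, k, l). (Suc i, j, k, l)) -` {m. c m \<noteq> 0}"])
  have fin: "finite {m. c m \<noteq> 0}"
    using assms by (simp add: poly_with_coeffs_def)
  show "finite ((\<lambda>(i, j, k, l). (Suc i, j, k, l)) -` {m. c m \<noteq> 0})"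
    by (rule finite_vimageI[OF fin]) (auto simp: inj_def)
  fix x y z w
  have f: "(\<lambda>v. f v y z w) = (\<lambda>v. \<Sum>m\<in>{m. c m \<noteq> 0}.
      case m of (i, j, k, l) \<Rightarrow> c (i, j, k, l) * v ^ i * y ^ j * z ^ k * w ^ l)"
    using assms by (simp add: poly_with_coeffs_def)
  have "((\<lambda>v. f v y z w) has_field_derivative
      (\<Sum>m\<in>{m. c m \<noteq> 0}. case m of (i, j, k, l) \<Rightarrow>
         c (i, j, k, l) * (of_nat i * x ^ (i - 1)) * y ^ j * z ^ k * w ^ l)) (at x)"
    unfolding f
    by (rule DERIV_sum) (auto intro!: derivative_eq_intros)
  then have "deriv (\<lambda>v. f v y z w) x = (\<Sum>m\<in>{m. c m \<noteq> 0}. case m of (i, j, k, l) \<Rightarrow>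
         c (i, j, k, l) * (of_nat i * x ^ (i - 1)) * y ^ j * z ^ k * w ^ l)"
    by (rule DERIV_imp_deriv)
  \<comment> \<open>The terms without \<open>x\<close> vanish; the others correspond to the shifted exponents.\<close>
  also have "\<dots> = (\<Sum>m\<in>{m. c m \<noteq> 0 \<and> fst m \<noteq> 0}. case m of (i, j, k, l) \<Rightarrow>
         c (i, j, k, l) * (of_nat i * x ^ (i - 1)) * y ^ j * z ^ k * w ^ l)"
    by (rule sum.mono_neutral_right) (use fin in auto)
  also have "{m. c m \<noteq> 0 \<and> fst m \<noteq> 0}
      = (\<lambda>(i, j, k, l). (Suc i, j, k, l)) ` ((\<lambda>(i, j, k, l). (Suc i, j, k, l)) -` {m. c m \<noteq> 0})"
    by (auto simp: image_iff gr0_conv_Suc)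
  also have "(\<Sum>m\<in>\<dots>. case m of (i, j, k, l) \<Rightarrow>
         c (i, j, k, l) * (of_nat i * x ^ (i - 1)) * y ^ j * z ^ k * w ^ l)
      = (\<Sum>(i, j, k, l)\<in>(\<lambda>(i, j, k, l). (Suc i, j, k, l)) -` {m. c m \<noteq> 0}.
      of_nat (Suc i) * c (Suc i, j, k, l) * x ^ i * y ^ j * z ^ k * w ^ l)"
    by (subst sum.reindex) (auto simp: inj_on_def case_prod_unfold mult_ac)
  finally show "deriv (\<lambda>v. f v y z w) x
      = (\<Sum>(i, j, k, l)\<in>(\<lambda>(i, j, k, l). (Suc i, j, k, l)) -` {m. c m \<noteq> 0}.
          (case (i, j, k, l) of (i, j, k, l) \<Rightarrow> of_nat (Suc i) * c (Suc i, j, k, l))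
            * x ^ i * y ^ j * z ^ k * w ^ l)"
    by simp
qed auto

text \<open>
  When each coefficient of the result is a constant multiple of a single coefficient of the
  argument, convergence passes through the operation one coefficient at a time. Negation,
  exchange of variables and differentiation are all of this kind.
\<close>

lemma tends_coeffwise_transport:
  assumes "tends_coeffwise f g"
    and op: "\<And>h c. poly_with_coeffs h c \<Longrightarrow> poly_with_coeffs (\<Phi> h) (\<lambda>m. \<kappa> m * c (\<sigma> m))"
  shows "tends_coeffwise (\<lambda>\<epsilon>. \<Phi> (f \<epsilon>)) (\<Phi> g)"
proof -
  obtain c d where f: "\<forall>\<^sub>F \<epsilon> in at 0. poly_with_coeffs (f \<epsilon>) (c \<epsilon>)"
    and g: "poly_with_coeffs g d" and lim: "\<And>m. ((\<lambda>\<epsilon>. c \<epsilon> m) \<longlongrightarrow> d m) (at 0)"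
    using assms(1) unfolding tends_coeffwise_def by blast
  have "\<forall>\<^sub>F \<epsilon> in at 0. poly_with_coeffs (\<Phi> (f \<epsilon>)) (\<lambda>m. \<kappa> m * c \<epsilon> (\<sigma> m))"
    using f by eventually_elim (rule op)
  moreover have "((\<lambda>\<epsilon>. \<kappa> m * c \<epsilon> (\<sigma> m)) \<longlongrightarrow> \<kappa> m * d (\<sigma> m)) (at 0)" for m
    by (intro tendsto_intros lim)
  ultimately show ?thesis
    unfolding tends_coeffwise_def using op[OF g] by fast
qed

lemma tends_coeffwise_uminus:
  "tends_coeffwise f g \<Longrightarrow>
    tends_coeffwise (\<lambda>\<epsilon> x y z w. - f \<epsilon> x y z w) (\<lambda>x y z w. - g x y z w)"
  by (erule tends_coeffwise_transport[where \<Phi> = "\<lambda>h x y z w. - h x y z w"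
        and \<kappa> = "\<lambda>_. - 1" and \<sigma> = "\<lambda>m. m"])
     (use poly_with_coeffs_uminus in simp)

lemma tends_coeffwise_swap_xy:
  "tends_coeffwise f g \<Longrightarrow> tends_coeffwise (\<lambda>\<epsilon> x y z w. f \<epsilon> y x z w) (\<lambda>x y z w. g y x z w)"
  by (erule tends_coeffwise_transport[where \<Phi> = "\<lambda>h x y z w. h y x z w"
        and \<kappa> = "\<lambda>_. 1" and \<sigma> = "\<lambda>(i, j, k, l). (j, i, k, l)"])
     (use poly_with_coeffs_swap_xy in \<open>simp add: case_prod_unfold\<close>)

lemma tends_coeffwise_swap_pairs:
  "tends_coeffwise f g \<Longrightarrow> tends_coeffwise (\<lambda>\<epsilon> x y z w. f \<epsilon> z w x y) (\<lambda>x y z w. g z w x y)"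
  by (erule tends_coeffwise_transport[where \<Phi> = "\<lambda>h x y z w. h z w x y"
        and \<kappa> = "\<lambda>_. 1" and \<sigma> = "\<lambda>(i, j, k, l). (k, l, i, j)"])
     (use poly_with_coeffs_swap_pairs in \<open>simp add: case_prod_unfold\<close>)

lemma tends_coeffwise_deriv_fst:
  "tends_coeffwise f g \<Longrightarrow> tends_coeffwise (\<lambda>\<epsilon> x y z w. deriv (\<lambda>v. f \<epsilon> v y z w) x)
     (\<lambda>x y z w. deriv (\<lambda>v. g v y z w) x)"
  by (erule tends_coeffwise_transport[where \<Phi> = "\<lambda>h x y z w. deriv (\<lambda>v. h v y z w) x"
        and \<kappa> = "\<lambda>(i, j, k, l). of_nat (Suc i)" and \<sigma> = "\<lambda>(i, j, k, l). (Suc i, j, k, l)"])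
     (use poly_with_coeffs_deriv_fst in \<open>simp add: case_prod_unfold\<close>)

text \<open>
  The other three partial derivatives are the first one, conjugated by exchanges of variables.
\<close>

lemma tends_coeffwise_rhs:
  assumes "tends_coeffwise (\<lambda>\<epsilon>. F \<epsilon> T) (G T)"
  shows "tends_coeffwise (\<lambda>\<epsilon>. rhs_x (F \<epsilon>) T) (rhs_x G T)"
    and "tends_coeffwise (\<lambda>\<epsilon>. rhs_y (F \<epsilon>) T) (rhs_y G T)"
    and "tends_coeffwise (\<lambda>\<epsilon>. rhs_z (F \<epsilon>) T) (rhs_z G T)"
    and "tends_coeffwise (\<lambda>\<epsilon>. rhs_w (F \<epsilon>) T) (rhs_w G T)"
proof -
  note swap = tends_coeffwise_swap_xy and pairs = tends_coeffwise_swap_pairs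
    and d = tends_coeffwise_deriv_fst and neg = tends_coeffwise_uminus
  show "tends_coeffwise (\<lambda>\<epsilon>. rhs_x (F \<epsilon>) T) (rhs_x G T)"
    using swap[OF d[OF swap[OF assms]]] by (simp add: rhs_x_def[abs_def])
  show "tends_coeffwise (\<lambda>\<epsilon>. rhs_y (F \<epsilon>) T) (rhs_y G T)"
    using neg[OF d[OF assms]] by (simp add: rhs_y_def[abs_def])
  show "tends_coeffwise (\<lambda>\<epsilon>. rhs_z (F \<epsilon>) T) (rhs_z G T)"
    using pairs[OF swap[OF d[OF swap[OF pairs[OF assms]]]]] by (simp add: rhs_z_def[abs_def])
  show "tends_coeffwise (\<lambda>\<epsilon>. rhs_w (F \<epsilon>) T) (rhs_w G T)"
    using neg[OF pairs[OF d[OF pairs[OF assms]]]] by (simp add: rhs_w_def[abs_def])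
qed

section \<open>Hamiltonian systems under scaling\<close>

lemma has_field_derivative_rescale_iff:
  fixes u U :: "complex \<Rightarrow> complex"
  assumes "open V" "T \<in> V" "\<epsilon> \<noteq> 0" "a \<noteq> 0"
    and u: "\<And>S. S \<in> V \<Longrightarrow> u (S / \<epsilon>) = a * U S"
  shows "(u has_field_derivative D) (at (T / \<epsilon>)) \<longleftrightarrow>
         (U has_field_derivative D / (a * \<epsilon>)) (at T)"
proof
  assume D: "(u has_field_derivative D) (at (T / \<epsilon>))"
  have "((\<lambda>S. u (S / \<epsilon>) / a) has_field_derivative D / (a * \<epsilon>)) (at T)"
    by (rule derivative_eq_intros DERIV_chain2[where g = "\<lambda>S. S / \<epsilon>", OF D] refl | use assms in \<open>simp add: field_simps\<close>)+
  then show "(U has_field_derivative D / (a * \<epsilon>)) (at T)"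
    by (rule has_field_derivative_transform_within_open[OF _ \<open>open V\<close> \<open>T \<in> V\<close>])
       (use u \<open>a \<noteq> 0\<close> in simp)
next
  assume "(U has_field_derivative D / (a * \<epsilon>)) (at T)"
  then have D: "(U has_field_derivative D / (a * \<epsilon>)) (at (\<epsilon> * (T / \<epsilon>)))"
    using \<open>\<epsilon> \<noteq> 0\<close> by simp
  have "((\<lambda>t. a * U (\<epsilon> * t)) has_field_derivative D) (at (T / \<epsilon>))"
    by (rule derivative_eq_intros DERIV_chain2[where g = "\<lambda>t. \<epsilon> * t", OF D] refl | use assms in \<open>simp add: field_simps\<close>)+
  moreover have "open ((\<lambda>t. \<epsilon> * t) -` V)"
    by (intro open_vimage \<open>open V\<close> continuous_intros)
  moreover have "T / \<epsilon> \<in> (\<lambda>t. \<epsilon> * t) -` V"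
    using assms by simp
  moreover have "a * U (\<epsilon> * t) = u t" if "t \<in> (\<lambda>t. \<epsilon> * t) -` V" for t
    using u[of "\<epsilon> * t"] that \<open>\<epsilon> \<noteq> 0\<close> by simp
  ultimately show "(u has_field_derivative D) (at (T / \<epsilon>))"
    by (rule has_field_derivative_transform_within_open)
qed

lemma deriv_rescale:
  fixes g :: "complex \<Rightarrow> complex"
  assumes "\<And>v. g field_differentiable at v" "e \<noteq> 0"
  shows "deriv (\<lambda>v. g (b * v) / e) y = b * deriv g (b * y) / e"
proof (rule DERIV_imp_deriv)
  have D: "(g has_field_derivative deriv g (b * y)) (at (b * y))"
    using assms by (simp add: DERIV_deriv_iff_field_differentiable)
  show "((\<lambda>v. g (b * v) / e) has_field_derivative b * deriv g (b * y) / e) (at y)"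
    by (rule derivative_eq_intros DERIV_chain2[where g = "\<lambda>v. b * v", OF D] refl | use assms in simp)+
qed

text \<open>
  Scaling the two members of a conjugate pair by inverse factors is canonical, so such a scaling
  transforms the Hamiltonian as a function; the factor \<open>1/\<epsilon>\<close> is \<open>dt/dT\<close>.
\<close>

lemma solves_hamiltonian_system_rescale:
  fixes F G :: "complex \<Rightarrow> phase_fun"
  assumes "open V" and nz: "\<epsilon> \<noteq> 0" "a \<noteq> 0" "b \<noteq> 0"
    and diff: "\<And>T x y z w. T \<in> V \<Longrightarrow> (\<lambda>v. F (T / \<epsilon>) v y z w) field_differentiable at x"
      "\<And>T x y z w. T \<in> V \<Longrightarrow> (\<lambda>v. F (T / \<epsilon>) x v z w) field_differentiable at y"
      "\<And>T x y z w. T \<in> V \<Longrightarrow> (\<lambda>v. F (T / \<epsilon>) x y v w) field_differentiable at z"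
      "\<And>T x y z w. T \<in> V \<Longrightarrow> (\<lambda>v. F (T / \<epsilon>) x y z v) field_differentiable at w"
    and G: "\<And>T X Y Z W. T \<in> V \<Longrightarrow>
      G T X Y Z W = F (T / \<epsilon>) (a * X) (Y / a) (b * Z) (W / b) / \<epsilon>"
    and subst: "\<And>T. T \<in> V \<Longrightarrow> x (T / \<epsilon>) = a * X T" "\<And>T. T \<in> V \<Longrightarrow> y (T / \<epsilon>) = Y T / a"
      "\<And>T. T \<in> V \<Longrightarrow> z (T / \<epsilon>) = b * Z T" "\<And>T. T \<in> V \<Longrightarrow> w (T / \<epsilon>) = W T / b"
  shows "solves_hamiltonian_system F ((\<lambda>T. T / \<epsilon>) ` V) x y z w \<longleftrightarrow>
         solves_hamiltonian_system G V X Y Z W"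
proof -
  have rhs: "rhs_x G T X Y Z W = rhs_x F (T / \<epsilon>) (a * X) (Y / a) (b * Z) (W / b) / (a * \<epsilon>)"
    "rhs_y G T X Y Z W = rhs_y F (T / \<epsilon>) (a * X) (Y / a) (b * Z) (W / b) / (inverse a * \<epsilon>)"
    "rhs_z G T X Y Z W = rhs_z F (T / \<epsilon>) (a * X) (Y / a) (b * Z) (W / b) / (b * \<epsilon>)"
    "rhs_w G T X Y Z W = rhs_w F (T / \<epsilon>) (a * X) (Y / a) (b * Z) (W / b) / (inverse b * \<epsilon>)"
    if T: "T \<in> V" for T X Y Z W
    using deriv_rescale[OF diff(1)[OF T] nz(1), where b = a]
      deriv_rescale[OF diff(2)[OF T] nz(1), where b = "inverse a"]
      deriv_rescale[OF diff(3)[OF T] nz(1), where b = b]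
      deriv_rescale[OF diff(4)[OF T] nz(1), where b = "inverse b"]
    by (simp_all add: rhs_x_def rhs_y_def rhs_z_def rhs_w_def G[OF T] field_simps)
  have "(x has_field_derivative D) (at (T / \<epsilon>)) \<longleftrightarrow>
        (X has_field_derivative D / (a * \<epsilon>)) (at T)"
    "(y has_field_derivative D) (at (T / \<epsilon>)) \<longleftrightarrow>
        (Y has_field_derivative D / (inverse a * \<epsilon>)) (at T)"
    "(z has_field_derivative D) (at (T / \<epsilon>)) \<longleftrightarrow>
        (Z has_field_derivative D / (b * \<epsilon>)) (at T)"
    "(w has_field_derivative D) (at (T / \<epsilon>)) \<longleftrightarrow>
        (W has_field_derivative D / (inverse b * \<epsilon>)) (at T)"
    if "T \<in> V" for T D
    using that nz subst
    by (intro has_field_derivative_rescale_iff[OF \<open>open V\<close>]; simp add: field_simps)+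
  then show ?thesis
    by (simp add: solves_hamiltonian_system_def rhs subst)
qed

section \<open>The rescaled Hamiltonian as a deformation of the limiting one\<close>

text \<open>
  The Hamiltonian of the rescaled system with the powers of \<open>\<epsilon>\<close> cancelled, so that \<open>\<epsilon> = 0\<close>
  is an admissible value.
\<close>

definition H_deformed ::
  "complex \<Rightarrow> complex \<Rightarrow> complex \<Rightarrow> complex \<Rightarrow> complex \<Rightarrow> complex \<Rightarrow> phase_fun" where
  "H_deformed A0 A1 A2 A3 \<epsilon> T X Y Z W =
     (X^2 * Y^3 - ((T + \<epsilon>) * X + 2 * A1 + A2 + A3) * X * Y^2
      + (\<epsilon> * T * X^2 + (1 + \<epsilon> * (A0 + 2 * A1 + A2 + A3) - A0 * T) * X + A1 * (A1 + A2 + A3)) * Y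
      - T * X
      + (1 / 4) * (- (Z^2 * W^4) + 2 * A3 * Z * W^3 + ((2 * T - \<epsilon>) * Z^2 - A3^2) * W^2
          - 2 * (- 1 - \<epsilon> * (A0 + 2 * A1 + A2 + A3) + (A3 + 1) * T) * Z * W - T * (T - \<epsilon>) * Z^2)
      + Y * ((Y - \<epsilon>) * X - A1) * Z * W)
     / (T * (T - \<epsilon>))"

lemma H_deformed_0: "H_deformed A0 A1 A2 A3 0 = H_limit A0 A1 A2 A3"
  by (intro ext) (simp add: H_deformed_def H_limit_def power2_eq_square algebra_simps)

lemma H_A7_rescaled:
  assumes nz: "\<epsilon> \<noteq> 0" "T \<noteq> 0" "T \<noteq> \<epsilon>" and s: "s^2 = \<epsilon>"
  shows "H_A7 (1 / \<epsilon> + A0) (- (1 / \<epsilon>)) A1 A2 A3 (T / \<epsilon>) (\<epsilon> * X) (Y / \<epsilon>) (s * Z) (W / s) / \<epsilon>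
       = H_deformed A0 A1 A2 A3 \<epsilon> T X Y Z W"
proof -
  have s0: "s \<noteq> 0"
    using nz s by auto
  \<comment> \<open>Every monomial in \<open>z, w\<close> of the Hamiltonian is a product of these, so \<open>s\<close> enters it
    only through \<open>s\<^sup>2\<close>.\<close>
  have pows: "(s * Z)^2 = \<epsilon> * Z^2" "(W / s)^2 = W^2 / \<epsilon>"
    "(s * Z) * (W / s)^3 = Z * W^3 / \<epsilon>" "(W / s)^4 = W^4 / \<epsilon>^2" "(s * Z) * (W / s) = Z * W"
    using s0 unfolding s[symmetric]
    by (simp_all add: power_mult_distrib power_divide field_simps eval_nat_numeral)
  \<comment> \<open>The factor \<open>\<epsilon>\<close> removes the simple pole of the numerator.\<close>
  define N where "N = \<epsilon> * (
      (\<epsilon> * X)^2 * (Y / \<epsilon>)^3 - ((T / \<epsilon> + 1) * (\<epsilon> * X) + 2 * A1 + A2 + A3) * (\<epsilon> * X) * (Y / \<epsilon>)^2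
      + (T / \<epsilon> * (\<epsilon> * X)^2 + (1 / \<epsilon> + A0 + 2 * A1 + A2 + A3
           - (1 / \<epsilon> + A0 + - (1 / \<epsilon>)) * (T / \<epsilon>)) * (\<epsilon> * X) + A1 * (A1 + A2 + A3)) * (Y / \<epsilon>)
      + - (1 / \<epsilon>) * (T / \<epsilon>) * (\<epsilon> * X)
      + (1 / 4) * (- (\<epsilon> * Z^2 * (W^4 / \<epsilon>^2)) + 2 * A3 * (Z * W^3 / \<epsilon>)
          + ((2 * (T / \<epsilon>) - 1) * (\<epsilon> * Z^2) - A3^2) * (W^2 / \<epsilon>)
          - 2 * (- (1 / \<epsilon> + A0) - 2 * A1 - A2 - A3 + (A3 + 1) * (T / \<epsilon>)) * (Z * W)
          - (T / \<epsilon>) * (T / \<epsilon> - 1) * (\<epsilon> * Z^2))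
      + (Y / \<epsilon>) * ((Y / \<epsilon> - 1) * (\<epsilon> * X) - A1) * (Z * W))"
  have den: "T / \<epsilon> * (T / \<epsilon> - 1) = T * (T - \<epsilon>) / \<epsilon>^2"
    using nz by (simp add: field_simps power2_eq_square)
  have "H_A7 (1 / \<epsilon> + A0) (- (1 / \<epsilon>)) A1 A2 A3 (T / \<epsilon>) (\<epsilon> * X) (Y / \<epsilon>) (s * Z) (W / s) / \<epsilon>
      = N / \<epsilon> / (T * (T - \<epsilon>) / \<epsilon>^2) / \<epsilon>"
    unfolding H_A7_def N_def den pows(1,2,4) pows(3,5)[symmetric]
    using nz by (simp add: mult.assoc)
  also have "\<dots> = N / (T * (T - \<epsilon>))"
    using nz by (simp add: power2_eq_square)
  also have "N = X^2 * Y^3 - ((T + \<epsilon>) * X + 2 * A1 + A2 + A3) * X * Y^2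
      + (\<epsilon> * T * X^2 + (1 + \<epsilon> * (A0 + 2 * A1 + A2 + A3) - A0 * T) * X + A1 * (A1 + A2 + A3)) * Y
      - T * X
      + (1 / 4) * (- (Z^2 * W^4) + 2 * A3 * Z * W^3 + ((2 * T - \<epsilon>) * Z^2 - A3^2) * W^2
          - 2 * (- 1 - \<epsilon> * (A0 + 2 * A1 + A2 + A3) + (A3 + 1) * T) * Z * W - T * (T - \<epsilon>) * Z^2)
      + Y * ((Y - \<epsilon>) * X - A1) * Z * W"
    unfolding N_def using nz(1) by (simp add: field_simps eval_nat_numeral)
  finally show ?thesis
    by (simp add: H_deformed_def)
qed

lemma H_A7_field_differentiable:
  "(\<lambda>v. H_A7 \<alpha>0 \<alpha>1 \<alpha>2 \<alpha>3 \<alpha>4 t v y z w) field_differentiable at x"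
  "(\<lambda>v. H_A7 \<alpha>0 \<alpha>1 \<alpha>2 \<alpha>3 \<alpha>4 t x v z w) field_differentiable at y"
  "(\<lambda>v. H_A7 \<alpha>0 \<alpha>1 \<alpha>2 \<alpha>3 \<alpha>4 t x y v w) field_differentiable at z"
  "(\<lambda>v. H_A7 \<alpha>0 \<alpha>1 \<alpha>2 \<alpha>3 \<alpha>4 t x y z v) field_differentiable at w"
  \<comment> \<open>Division by the constant denominator is read as multiplication by its inverse, which
    covers the values of \<open>t\<close> where it vanishes.\<close>
  unfolding H_A7_def divide_inverse[of _ "t * (t - 1)"]
  by (intro derivative_intros)+

definition H_deformed_coeffs ::
  "complex \<Rightarrow> complex \<Rightarrow> complex \<Rightarrow> complex \<Rightarrow> complex \<Rightarrow> complex \<Rightarrow>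
   nat \<times> nat \<times> nat \<times> nat \<Rightarrow> complex" where
  "H_deformed_coeffs A0 A1 A2 A3 \<epsilon> T m =
     ((\<lambda>_. 0)(
       (2, 3, 0, 0) := 1,
       (2, 2, 0, 0) := - (T + \<epsilon>),
       (1, 2, 0, 0) := - (2 * A1 + A2 + A3),
       (2, 1, 0, 0) := \<epsilon> * T,
       (1, 1, 0, 0) := 1 + \<epsilon> * (A0 + 2 * A1 + A2 + A3) - A0 * T,
       (0, 1, 0, 0) := A1 * (A1 + A2 + A3),
       (1, 0, 0, 0) := - T,
       (0, 0, 2, 4) := - (1 / 4),
       (0, 0, 1, 3) := A3 / 2,
       (0, 0, 2, 2) := (2 * T - \<epsilon>) / 4,
       (0, 0, 0, 2) := - (A3^2 / 4),
       (0, 0, 1, 1) := (1 + \<epsilon> * (A0 + 2 * A1 + A2 + A3) - (A3 + 1) * T) / 2,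
       (0, 0, 2, 0) := - (T * (T - \<epsilon>) / 4),
       (1, 2, 1, 1) := 1,
       (1, 1, 1, 1) := - \<epsilon>,
       (0, 1, 1, 1) := - A1)) m / (T * (T - \<epsilon>))"

lemma poly_with_coeffs_H_deformed:
  "poly_with_coeffs (H_deformed A0 A1 A2 A3 \<epsilon> T) (H_deformed_coeffs A0 A1 A2 A3 \<epsilon> T)"
proof (rule poly_with_coeffsI[where S = "{(2, 3, 0, 0), (2, 2, 0, 0), (1, 2, 0, 0), (2, 1, 0, 0),
    (1, 1, 0, 0), (0, 1, 0, 0), (1, 0, 0, 0), (0, 0, 2, 4), (0, 0, 1, 3), (0, 0, 2, 2),
    (0, 0, 0, 2), (0, 0, 1, 1), (0, 0, 2, 0), (1, 2, 1, 1), (1, 1, 1, 1), (0, 1, 1, 1)}"])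
  fix x y z w
  \<comment> \<open>With the inverse of the denominator abstracted, the two sides agree as polynomials, also
    where that denominator is 0.\<close>
  define r where "r = inverse (T * (T - \<epsilon>))"
  show "H_deformed A0 A1 A2 A3 \<epsilon> T x y z w = (\<Sum>(i, j, k, l)\<in>{(2, 3, 0, 0), (2, 2, 0, 0),
      (1, 2, 0, 0), (2, 1, 0, 0), (1, 1, 0, 0), (0, 1, 0, 0), (1, 0, 0, 0), (0, 0, 2, 4),
      (0, 0, 1, 3), (0, 0, 2, 2), (0, 0, 0, 2), (0, 0, 1, 1), (0, 0, 2, 0), (1, 2, 1, 1),
      (1, 1, 1, 1), (0, 1, 1, 1)}.
      H_deformed_coeffs A0 A1 A2 A3 \<epsilon> T (i, j, k, l) * x ^ i * y ^ j * z ^ k * w ^ l)"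
    unfolding H_deformed_def H_deformed_coeffs_def divide_inverse[of _ "T * (T - \<epsilon>)"]
      r_def[symmetric]
    by (simp add: eval_nat_numeral field_simps)
qed (auto simp: H_deformed_coeffs_def)

lemma isCont_H_deformed_coeffs:
  assumes "T \<noteq> 0"
  shows "isCont (\<lambda>\<epsilon>. H_deformed_coeffs A0 A1 A2 A3 \<epsilon> T m) 0"
proof -
  \<comment> \<open>Which entry of the table is read off does not depend on \<open>\<epsilon>\<close>.\<close>
  have upd: "isCont (\<lambda>\<epsilon>. ((g \<epsilon>)(k := f \<epsilon>)) n) 0"
    if "isCont f 0" "isCont (\<lambda>\<epsilon>. g \<epsilon> n) 0"
    for f :: "complex \<Rightarrow> complex" and g and k n :: "nat \<times> nat \<times> nat \<times> nat"
    using that by (cases "n = k") simp_all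
  show ?thesis
    unfolding H_deformed_coeffs_def using assms
    by (intro upd continuous_intros) simp_all
qed

lemma tends_coeffwise_H_deformed:
  assumes "T \<noteq> 0"
  shows "tends_coeffwise (\<lambda>\<epsilon>. H_deformed A0 A1 A2 A3 \<epsilon> T) (H_limit A0 A1 A2 A3 T)"
  unfolding tends_coeffwise_def
proof (intro exI conjI allI)
  show "\<forall>\<^sub>F \<epsilon> in at 0. poly_with_coeffs (H_deformed A0 A1 A2 A3 \<epsilon> T)
      (H_deformed_coeffs A0 A1 A2 A3 \<epsilon> T)"
    by (simp add: poly_with_coeffs_H_deformed)
  show "poly_with_coeffs (H_limit A0 A1 A2 A3 T) (H_deformed_coeffs A0 A1 A2 A3 0 T)"
    using poly_with_coeffs_H_deformed[of A0 A1 A2 A3 0 T] by (simp add: H_deformed_0)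
  show "((\<lambda>\<epsilon>. H_deformed_coeffs A0 A1 A2 A3 \<epsilon> T m) \<longlongrightarrow> H_deformed_coeffs A0 A1 A2 A3 0 T m) (at 0)"
    for m
    using isCont_H_deformed_coeffs[OF assms] by (simp add: isCont_def)
qed

section \<open>The degeneration\<close>

theorem theorem3p1:
  fixes A0 A1 A2 A3 :: complex
    and \<alpha>0 \<alpha>1 \<alpha>2 \<alpha>3 \<alpha>4 :: "complex \<Rightarrow> complex"
    and sqrt_of :: "complex \<Rightarrow> complex"
  assumes constraint:
      "\<And>\<epsilon>. \<epsilon> \<noteq> 0 \<Longrightarrow> \<alpha>0 \<epsilon> + \<alpha>1 \<epsilon> + 2 * \<alpha>2 \<epsilon> + 2 * \<alpha>3 \<epsilon> + \<alpha>4 \<epsilon> = 1"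
    and params:
      "\<And>\<epsilon>. \<epsilon> \<noteq> 0 \<Longrightarrow> \<alpha>0 \<epsilon> = 1 / \<epsilon> + A0 \<and> \<alpha>1 \<epsilon> = - (1 / \<epsilon>) \<and> \<alpha>2 \<epsilon> = A1 \<and> \<alpha>3 \<epsilon> = A2 \<and> \<alpha>4 \<epsilon> = A3"
    and sqrt_of: "\<And>\<epsilon>. \<epsilon> \<noteq> 0 \<Longrightarrow> (sqrt_of \<epsilon>)^2 = \<epsilon>"
  shows "A0 + 2 * A1 + 2 * A2 + A3 = 1 \<and>
    (\<exists>K :: complex \<Rightarrow> complex \<Rightarrow> phase_fun.
      (\<forall>\<epsilon>. \<epsilon> \<noteq> 0 \<longrightarrow>
        (\<forall>T. T \<noteq> 0 \<and> T \<noteq> \<epsilon> \<longrightarrow> is_poly_fun (K \<epsilon> T)) \<and>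
        (\<forall>V x y z w X Y Z W.
          open V \<and> 0 \<notin> V \<and> \<epsilon> \<notin> V \<and>
          (\<forall>T\<in>V. x (T / \<epsilon>) = \<epsilon> * X T \<and> y (T / \<epsilon>) = Y T / \<epsilon> \<and>
                 z (T / \<epsilon>) = sqrt_of \<epsilon> * Z T \<and> w (T / \<epsilon>) = W T / sqrt_of \<epsilon>) \<longrightarrow>
          (solves_hamiltonian_system (H_A7 (\<alpha>0 \<epsilon>) (\<alpha>1 \<epsilon>) (\<alpha>2 \<epsilon>) (\<alpha>3 \<epsilon>) (\<alpha>4 \<epsilon>))
             ((\<lambda>T. T / \<epsilon>) ` V) x y z w
           \<longleftrightarrow> solves_hamiltonian_system (K \<epsilon>) V X Y Z W))) \<and>
      (\<forall>T. T \<noteq> 0 \<longrightarrow>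
        is_poly_fun (H_limit A0 A1 A2 A3 T) \<and>
        tends_coeffwise (\<lambda>\<epsilon>. rhs_x (K \<epsilon>) T) (rhs_x (H_limit A0 A1 A2 A3) T) \<and>
        tends_coeffwise (\<lambda>\<epsilon>. rhs_y (K \<epsilon>) T) (rhs_y (H_limit A0 A1 A2 A3) T) \<and>
        tends_coeffwise (\<lambda>\<epsilon>. rhs_z (K \<epsilon>) T) (rhs_z (H_limit A0 A1 A2 A3) T) \<and>
        tends_coeffwise (\<lambda>\<epsilon>. rhs_w (K \<epsilon>) T) (rhs_w (H_limit A0 A1 A2 A3) T)))"
proof (intro conjI exI[of _ "H_deformed A0 A1 A2 A3"] allI impI)
  show "A0 + 2 * A1 + 2 * A2 + A3 = 1"
    using constraint[of 1] params[of 1] by simp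
next
  fix \<epsilon> T :: complex
  show "is_poly_fun (H_deformed A0 A1 A2 A3 \<epsilon> T)"
    using poly_with_coeffs_H_deformed is_poly_fun_def by blast
next
  fix \<epsilon> :: complex and V x y z w X Y Z W
  assume \<epsilon>: "\<epsilon> \<noteq> 0"
    and V: "open V \<and> 0 \<notin> V \<and> \<epsilon> \<notin> V \<and>
          (\<forall>T\<in>V. x (T / \<epsilon>) = \<epsilon> * X T \<and> y (T / \<epsilon>) = Y T / \<epsilon> \<and>
                 z (T / \<epsilon>) = sqrt_of \<epsilon> * Z T \<and> w (T / \<epsilon>) = W T / sqrt_of \<epsilon>)"
  have s: "sqrt_of \<epsilon> \<noteq> 0"
    using sqrt_of[OF \<epsilon>] \<epsilon> by auto
  have par: "\<alpha>0 \<epsilon> = 1 / \<epsilon> + A0" "\<alpha>1 \<epsilon> = - (1 / \<epsilon>)" "\<alpha>2 \<epsilon> = A1" "\<alpha>3 \<epsilon> = A2" "\<alpha>4 \<epsilon> = A3"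
    using params[OF \<epsilon>] by auto
  show "solves_hamiltonian_system (H_A7 (\<alpha>0 \<epsilon>) (\<alpha>1 \<epsilon>) (\<alpha>2 \<epsilon>) (\<alpha>3 \<epsilon>) (\<alpha>4 \<epsilon>))
          ((\<lambda>T. T / \<epsilon>) ` V) x y z w
        \<longleftrightarrow> solves_hamiltonian_system (H_deformed A0 A1 A2 A3 \<epsilon>) V X Y Z W"
    unfolding par
  proof (rule solves_hamiltonian_system_rescale[OF _ \<epsilon> \<epsilon> s H_A7_field_differentiable])
    show "H_deformed A0 A1 A2 A3 \<epsilon> T X Y Z W
        = H_A7 (1 / \<epsilon> + A0) (- (1 / \<epsilon>)) A1 A2 A3 (T / \<epsilon>)
            (\<epsilon> * X) (Y / \<epsilon>) (sqrt_of \<epsilon> * Z) (W / sqrt_of \<epsilon>) / \<epsilon>"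
      if "T \<in> V" for T X Y Z W
      using that V \<epsilon> sqrt_of[OF \<epsilon>] by (intro H_A7_rescaled[symmetric]) auto
  qed (use V in auto)
next
  fix T :: complex
  assume "T \<noteq> 0"
  note lim = tends_coeffwise_H_deformed[OF this, of A0 A1 A2 A3]
  show "is_poly_fun (H_limit A0 A1 A2 A3 T)"
    using lim unfolding tends_coeffwise_def is_poly_fun_def by blast
  show "tends_coeffwise (\<lambda>\<epsilon>. rhs_x (H_deformed A0 A1 A2 A3 \<epsilon>) T) (rhs_x (H_limit A0 A1 A2 A3) T)"
    "tends_coeffwise (\<lambda>\<epsilon>. rhs_y (H_deformed A0 A1 A2 A3 \<epsilon>) T) (rhs_y (H_limit A0 A1 A2 A3) T)"
    "tends_coeffwise (\<lambda>\<epsilon>. rhs_z (H_deformed A0 A1 A2 A3 \<epsilon>) T) (rhs_z (H_limit A0 A1 A2 A3) T)"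
    "tends_coeffwise (\<lambda>\<epsilon>. rhs_w (H_deformed A0 A1 A2 A3 \<epsilon>) T) (rhs_w (H_limit A0 A1 A2 A3) T)"
    by (rule tends_coeffwise_rhs[where F = "H_deformed A0 A1 A2 A3" and G = "H_limit A0 A1 A2 A3", OF lim])+
qed

end
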